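(* Assume $\mathfrak p=\mathrm{cov}(\mathcal N)=\mathfrak c$. Then there exists a Cohen-indestructible mad family $\mathcal A$ on $\omega$ such that the Mathias forcing $M_{\mathcal F(\mathcal A)}$ adds a dominating real.
   Context: A family $\mathcal A\subset[\omega]^\omega$ is a mad family if it is infinite, $|A_0\cap A_1|<\omega$ for all distinct $A_0,A_1\in\mathcal A$, and every $B\in[\omega]^\omega\setminus\mathcal A$ has infinite intersection with some $A\in\mathcal A$. A mad family is Cohen-indestructible if it remains maximal in the generic extension by the Cohen forcing $\mathbb C$. For a mad family $\mathcal A$, $\mathcal F(\mathcal A)=\{F\subset\omega:\exists \mathcal A'\in[\mathcal A]^{<\omega}\,(\omega\setminus\bigcup\mathcal A'\subset^* F)\}$. For a filter $\mathcal F$ on $\omega$, the Mathias forcing $M_{\mathcal F}$ consists of pairs $(s,F)$ with $s\in[\omega]^{<\omega}$, $F\in\mathcal F$, ordered by $(t,G)\le(s,F)$ iff $t$ end-extends $s$, $G\subset F$ and $t\setminus s\subset F$. A forcing adds a dominating real if in the extension there is $g\in\omega^\omega$ with $f\le^* g$ for every ground-model $f\in\omega^\omega$. $\mathfrak p$ is the minimal size of a family $\mathcal X\subset[\omega]^\omega$ with all finite intersections infinite but no infinite $Y$ with $Y\subset^*X$ for all $X\in\mathcal X$; $\mathrm{cov}(\mathcal N)$ is the minimal number of Lebesgue null sets covering $\mathbb R$; $\mathfrak c=2^{\aleph_0}$. *)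

theory Defs
  imports "HOL-Analysis.Analysis"
begin

definition almost_subset :: "nat set \<Rightarrow> nat set \<Rightarrow> bool" where
  "almost_subset X Y \<longleftrightarrow> finite (X - Y)"

definition mad_family :: "nat set set \<Rightarrow> bool" where
  "mad_family \<A> \<longleftrightarrow>
     infinite \<A> \<and> (\<forall>A\<in>\<A>. infinite A) \<and>
     (\<forall>A0\<in>\<A>. \<forall>A1\<in>\<A>. A0 \<noteq> A1 \<longrightarrow> finite (A0 \<inter> A1)) \<and>
     (\<forall>B. infinite B \<and> B \<notin> \<A> \<longrightarrow> (\<exists>A\<in>\<A>. infinite (B \<inter> A)))"

definition F_of :: "nat set set \<Rightarrow> nat set set" where
  "F_of \<A> = {F. \<exists>\<A>'. \<A>' \<subseteq> \<A> \<and> finite \<A>' \<and> almost_subset (UNIV - \<Union>\<A>') F}"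

text \<open>A forcing notion is a carrier P with a preorder le (le q p: q is stronger than p).
  forces_meets P le S p: p forces that the generic filter meets S.
  A name for a subset of omega is given by sigma :: nat => 'p set (n is in the
  evaluation iff the generic filter meets sigma n); every name for a subset of omega
  is equivalent to one of this form.\<close>

definition forces_meets :: "'p set \<Rightarrow> ('p \<Rightarrow> 'p \<Rightarrow> bool) \<Rightarrow> 'p set \<Rightarrow> 'p \<Rightarrow> bool" where
  "forces_meets P le S p \<longleftrightarrow>
     (\<forall>q\<in>P. le q p \<longrightarrow> (\<exists>r\<in>P. le r q \<and> (\<exists>s\<in>S \<inter> P. le r s)))"

definition forces_inf_inter ::
  "'p set \<Rightarrow> ('p \<Rightarrow> 'p \<Rightarrow> bool) \<Rightarrow> (nat \<Rightarrow> 'p set) \<Rightarrow> nat set \<Rightarrow> 'p \<Rightarrow> bool" where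
  "forces_inf_inter P le \<sigma> A p \<longleftrightarrow>
     (\<forall>k::nat. \<forall>q\<in>P. le q p \<longrightarrow>
        (\<exists>r\<in>P. le r q \<and> (\<exists>n\<in>A. k \<le> n \<and> forces_meets P le (\<sigma> n) r)))"

definition forces_inf :: "'p set \<Rightarrow> ('p \<Rightarrow> 'p \<Rightarrow> bool) \<Rightarrow> (nat \<Rightarrow> 'p set) \<Rightarrow> 'p \<Rightarrow> bool" where
  "forces_inf P le \<sigma> p \<longleftrightarrow> forces_inf_inter P le \<sigma> UNIV p"

definition forces_maximal :: "'p set \<Rightarrow> ('p \<Rightarrow> 'p \<Rightarrow> bool) \<Rightarrow> nat set set \<Rightarrow> bool" where
  "forces_maximal P le \<A> \<longleftrightarrow>
     (\<forall>\<sigma> :: nat \<Rightarrow> 'p set. \<forall>p\<in>P. forces_inf P le \<sigma> p \<longrightarrow>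
        (\<exists>q\<in>P. le q p \<and> (\<exists>A\<in>\<A>. forces_inf_inter P le \<sigma> A q)))"

text \<open>Adding a dominating real. A name for g is given by tau :: nat => nat => 'p set,
  read as the relation {(n,m). generic meets tau n m}; it is forced to be total, and
  g(n) is the least m related to n. The forcing adds a dominating real iff some such
  name is forced to eventually dominate every ground-model f.\<close>
definition adds_dominating_real :: "'p set \<Rightarrow> ('p \<Rightarrow> 'p \<Rightarrow> bool) \<Rightarrow> bool" where
  "adds_dominating_real P le \<longleftrightarrow>
     (\<exists>\<tau> :: nat \<Rightarrow> nat \<Rightarrow> 'p set.
        (\<forall>n. \<forall>p\<in>P. \<exists>q\<in>P. le q p \<and> (\<exists>m. forces_meets P le (\<tau> n m) q)) \<and>
        (\<forall>f :: nat \<Rightarrow> nat. \<forall>p\<in>P. \<exists>q\<in>P. le q p \<and>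
           (\<exists>k. \<forall>n\<ge>k. \<forall>m<f n. \<not> (\<exists>r\<in>P. le r q \<and> forces_meets P le (\<tau> n m) r))))"

definition cohen_le :: "bool list \<Rightarrow> bool list \<Rightarrow> bool" where
  "cohen_le q p \<longleftrightarrow> (\<exists>r. q = p @ r)"

definition cohen_indestructible :: "nat set set \<Rightarrow> bool" where
  "cohen_indestructible \<A> \<longleftrightarrow> mad_family \<A> \<and> forces_maximal UNIV cohen_le \<A>"

definition end_extends :: "nat set \<Rightarrow> nat set \<Rightarrow> bool" where
  "end_extends t s \<longleftrightarrow> s \<subseteq> t \<and> (\<forall>x\<in>t - s. \<forall>y\<in>s. y < x)"

definition mathias_set :: "nat set set \<Rightarrow> (nat set \<times> nat set) set" where
  "mathias_set \<F> = {(s, F). finite s \<and> F \<in> \<F>}"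

definition mathias_le :: "(nat set \<times> nat set) \<Rightarrow> (nat set \<times> nat set) \<Rightarrow> bool" where
  "mathias_le q p \<longleftrightarrow>
     end_extends (fst q) (fst p) \<and> snd q \<subseteq> snd p \<and> fst q - fst p \<subseteq> snd p"

definition sfip :: "nat set set \<Rightarrow> bool" where
  "sfip \<X> \<longleftrightarrow> (\<forall>\<Y>. \<Y> \<subseteq> \<X> \<and> finite \<Y> \<and> \<Y> \<noteq> {} \<longrightarrow> infinite (\<Inter>\<Y>))"

definition p_witness :: "nat set set \<Rightarrow> bool" where
  "p_witness \<X> \<longleftrightarrow> (\<forall>X\<in>\<X>. infinite X) \<and> sfip \<X> \<and>
     \<not> (\<exists>Y. infinite Y \<and> (\<forall>X\<in>\<X>. almost_subset Y X))"

definition p_eq_c :: bool where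
  "p_eq_c \<longleftrightarrow> (\<exists>\<X>. p_witness \<X> \<and> ordIso2 (card_of \<X>) (card_of (UNIV :: nat set set))) \<and>
     (\<forall>\<X>. p_witness \<X> \<longrightarrow> ordLeq3 (card_of (UNIV :: nat set set)) (card_of \<X>))"

definition null_cover :: "real set set \<Rightarrow> bool" where
  "null_cover \<N> \<longleftrightarrow> \<N> \<subseteq> null_sets lebesgue \<and> \<Union>\<N> = UNIV"

definition covN_eq_c :: bool where
  "covN_eq_c \<longleftrightarrow> (\<exists>\<N>. null_cover \<N> \<and> ordIso2 (card_of \<N>) (card_of (UNIV :: nat set set))) \<and>
     (\<forall>\<N>. null_cover \<N> \<longrightarrow> ordLeq3 (card_of (UNIV :: nat set set)) (card_of \<N>))"

end

theory Submission imports Defs begin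

text \<open>The family is built by a recursion of length continuum. Fix pairwise disjoint finite cells,
  the c-th one of size 2^c, and group them into finite rows: row n k consists of k + 1 cells.
  All members A of the family are thin: A has at most one point in every cell and, for each n, at
  most one point in row n k for almost all k. By the pigeonhole principle a finite union of
  thin sets misses a cell of row n k for all large k, so the Mathias real contains, for every n, a
  cell of some row n k; let g n be the least such k. The real g is dominating as soon as
  for each f there is a member meeting all cells of row n k for all n and k < f n. Such a
  member picks one point of each of these cells at random: by the Borel-Cantelli lemma almost every
  choice is almost disjoint from a given thin set, and less than continuum many null sets do not
  cover the line.

  A Cohen name for an infinite set is treated by adding a set which meets infinitely often each of
  the countably many sets of values that the conditions leave possible; unless one of these sets is
  almost covered by finitely many earlier members, in which case one of those already works. The
  new set is glued from finite sets forming a pseudointersection of a family of fewer than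
  continuum many sets of (codes of) finite sets.\<close>

section \<open>Cardinality\<close>

definition below_continuum :: "'a set \<Rightarrow> bool" where
  "below_continuum S \<longleftrightarrow> ordLess2 (card_of S) (card_of (UNIV :: nat set set))"

lemma below_continuum_image:
  assumes "below_continuum S"
  shows "below_continuum (f ` S)"
  using assms card_of_image ordLeq_ordLess_trans unfolding below_continuum_def by blast

lemma below_continuum_Un:
  assumes "below_continuum S" "below_continuum T"
  shows "below_continuum (S \<union> T)"
proof -
  have "infinite (UNIV :: nat set set)"
    by (simp add: Finite_Set.finite_set)
  then show ?thesis
    using assms card_of_Un_ordLess_infinite unfolding below_continuum_def by blast
qed

lemma below_continuum_range_nat: "below_continuum (range (f :: nat \<Rightarrow> 'a))"
proof (rule below_continuum_image)
  show "below_continuum (UNIV :: nat set)"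
    using card_of_Pow[of "UNIV :: nat set"] by (simp add: below_continuum_def)
qed

lemma not_below_continuumI:
  assumes "ordLeq3 (card_of (UNIV :: nat set set)) (card_of S)"
  shows "\<not> below_continuum S"
  using assms not_ordLess_ordLeq unfolding below_continuum_def by blast

lemma pseudointersection_below_continuum:
  assumes "p_eq_c" "below_continuum \<X>" "\<And>X. X \<in> \<X> \<Longrightarrow> infinite X" "sfip \<X>"
  obtains Y where "infinite Y" "\<And>X. X \<in> \<X> \<Longrightarrow> finite (Y - X)"
proof -
  have "\<not> p_witness \<X>"
    using assms(1,2) not_below_continuumI unfolding p_eq_c_def by blast
  then show thesis
    using assms(3,4) that unfolding p_witness_def almost_subset_def by blast
qed

lemma null_sets_below_continuum_not_cover:
  assumes "covN_eq_c" "below_continuum \<N>" "\<N> \<subseteq> null_sets lebesgue"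
  obtains r :: real where "\<And>N. N \<in> \<N> \<Longrightarrow> r \<notin> N"
proof -
  have "\<not> null_cover \<N>"
    using assms(1,2) not_below_continuumI unfolding covN_eq_c_def by blast
  then show thesis
    using assms(3) that unfolding null_cover_def by blast
qed

section \<open>Cells and thin sets\<close>

text \<open>A uniformly chosen point of \<open>cell c\<close> equals a given one with probability
  \<open>1 / 2 ^ c\<close>, which is summable in c. Tagging by c makes the cells disjoint and puts
  all points of \<open>cell c\<close> at or above c.\<close>

definition cell :: "nat \<Rightarrow> nat set" where
  "cell c = (\<lambda>i. prod_encode (c, i)) ` {..<2 ^ c}"

definition cell_index :: "nat \<Rightarrow> nat \<Rightarrow> nat \<Rightarrow> nat" where
  "cell_index n k l = prod_encode (n, prod_encode (k, l))"

definition row :: "nat \<Rightarrow> nat \<Rightarrow> nat set" where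
  "row n k = (\<Union>l\<le>k. cell (cell_index n k l))"

text \<open>The first clause lets a random choice of points avoid the set almost surely up to
  finitely many cells. The second tolerates finitely many rows for each n, so a thin set can still
  meet every cell of \<open>row n k\<close> for all k below a prescribed bound.\<close>

definition thin :: "nat set \<Rightarrow> bool" where
  "thin A \<longleftrightarrow> (\<forall>c. \<forall>x\<in>A \<inter> cell c. \<forall>y\<in>A \<inter> cell c. x = y) \<and>
     (\<forall>n. \<exists>K. \<forall>k\<ge>K. \<forall>x\<in>A \<inter> row n k. \<forall>y\<in>A \<inter> row n k. x = y)"

lemma finite_cell: "finite (cell c)"
  by (simp add: cell_def)

lemma finite_row: "finite (row n k)"
  by (simp add: row_def finite_cell)

lemma cell_ge: "x \<in> cell c \<Longrightarrow> c \<le> x"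
  by (auto simp: cell_def le_prod_encode_1)

lemma cell_disjoint: "x \<in> cell c \<Longrightarrow> x \<in> cell d \<Longrightarrow> c = d"
  by (auto simp: cell_def)

lemma cell_index_eq_iff [simp]:
  "cell_index n k l = cell_index n' k' l' \<longleftrightarrow> n = n' \<and> k = k' \<and> l = l'"
  by (auto simp: cell_index_def)

lemma cell_index_ge: "n \<le> cell_index n k l" "k \<le> cell_index n k l"
  unfolding cell_index_def by (meson le_prod_encode_1 le_prod_encode_2 le_trans)+

lemma row_ge:
  assumes "x \<in> row n k"
  shows "n \<le> x" "k \<le> x"
  using assms cell_index_ge cell_ge unfolding row_def by (blast intro: le_trans)+

lemma thin_cellD: "thin A \<Longrightarrow> x \<in> A \<Longrightarrow> y \<in> A \<Longrightarrow> x \<in> cell c \<Longrightarrow> y \<in> cell c \<Longrightarrow> x = y"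
  unfolding thin_def by blast

text \<open>Past the thresholds of all members of \<C>, each member has at most one point in the
  row, hence meets at most one of its k + 1 cells, and these outnumber the members.\<close>

lemma finite_thin_union_misses_cell:
  assumes "finite \<C>" "\<And>A. A \<in> \<C> \<Longrightarrow> thin A"
  obtains k l where "m \<le> k" "l \<le> k" "cell (cell_index n k l) \<inter> \<Union>\<C> = {}"
proof -
  have "\<forall>A\<in>\<C>. \<exists>K. \<forall>k\<ge>K. \<forall>x\<in>A \<inter> row n k. \<forall>y\<in>A \<inter> row n k. x = y"
    using assms(2) unfolding thin_def by blast
  then obtain K where K: "\<And>A k x y. A \<in> \<C> \<Longrightarrow> K A \<le> k \<Longrightarrow> x \<in> A \<inter> row n k \<Longrightarrow> y \<in> A \<inter> row n k \<Longrightarrow> x = y"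
    by metis
  \<comment> \<open>The summands secure the lower bound m, more cells than members, and a value
    beyond every threshold \<open>K A\<close>.\<close>
  define k where "k = m + card \<C> + (\<Sum>A\<in>\<C>. K A)"
  have K_le: "K A \<le> k" if "A \<in> \<C>" for A
    using member_le_sum[of A \<C> K] that assms(1) by (simp add: k_def)
  have "\<exists>l\<le>k. cell (cell_index n k l) \<inter> \<Union>\<C> = {}"
  proof (rule ccontr)
    assume "\<not> ?thesis"
    then have "\<forall>l\<in>{..k}. \<exists>A. A \<in> \<C> \<and> (\<exists>x. x \<in> cell (cell_index n k l) \<inter> A)"
      by blast
    then obtain pick where pick: "\<And>l. l \<le> k \<Longrightarrow> pick l \<in> \<C>"
      "\<And>l. l \<le> k \<Longrightarrow> \<exists>x. x \<in> cell (cell_index n k l) \<inter> pick l"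
      by (metis atMost_iff)
    have "inj_on pick {..k}"
    proof (rule inj_onI)
      fix l l' assume l: "l \<in> {..k}" "l' \<in> {..k}" "pick l = pick l'"
      then obtain x y where xy: "x \<in> cell (cell_index n k l) \<inter> pick l"
        "y \<in> cell (cell_index n k l') \<inter> pick l"
        using pick(2) by (metis atMost_iff)
      then have "x = y"
        using K[of "pick l" k x y] K_le[of "pick l"] pick(1)[of l] l unfolding row_def by auto
      then show "l = l'"
        using xy cell_disjoint by fastforce
    qed
    then have "card {..k} \<le> card \<C>"
      using pick(1) assms(1) by (intro card_inj_on_le[of pick]) auto
    then show False
      by (simp add: k_def)
  qed
  moreover have "m \<le> k"
    by (simp add: k_def)
  ultimately show thesis
    using that by blast
qed

text \<open>Any point sharing a cell or row with x is at most this value, because the parameters of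
  that cell or row are at most x.\<close>

definition cell_bound :: "nat \<Rightarrow> nat" where
  "cell_bound x = Max (insert x ((\<Union>n\<le>x. \<Union>k\<le>x. row n k) \<union> (\<Union>c\<le>x. cell c)))"

lemma cell_bound_ge:
  "x \<le> cell_bound x"
  "n \<le> x \<Longrightarrow> k \<le> x \<Longrightarrow> y \<in> row n k \<Longrightarrow> y \<le> cell_bound x"
  "c \<le> x \<Longrightarrow> y \<in> cell c \<Longrightarrow> y \<le> cell_bound x"
  unfolding cell_bound_def by (rule Max_ge; auto simp: finite_row finite_cell)+

lemma mono_cell_bound: "mono cell_bound"
proof (rule monoI)
  fix x y :: nat assume "x \<le> y"
  have "cell_bound x \<in> insert x ((\<Union>n\<le>x. \<Union>k\<le>x. row n k) \<union> (\<Union>c\<le>x. cell c))"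
    unfolding cell_bound_def by (rule Max_in) (auto simp: finite_row finite_cell)
  then consider "cell_bound x = x" | n k where "n \<le> x" "k \<le> x" "cell_bound x \<in> row n k"
    | c where "c \<le> x" "cell_bound x \<in> cell c"
    by auto
  then show "cell_bound x \<le> cell_bound y"
  proof cases
    case 1
    then show ?thesis
      using \<open>x \<le> y\<close> cell_bound_ge(1)[of y] by simp
  next
    case 2
    then show ?thesis
      using \<open>x \<le> y\<close> by (intro cell_bound_ge(2)[of n _ k]) auto
  next
    case 3
    then show ?thesis
      using \<open>x \<le> y\<close> by (intro cell_bound_ge(3)[of c]) auto
  qed
qed

definition spread :: "(nat \<Rightarrow> nat) \<Rightarrow> nat set \<Rightarrow> bool" where
  "spread h A \<longleftrightarrow> (\<forall>x\<in>A. \<forall>y\<in>A. x < y \<longrightarrow> h x < y)"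

text \<open>Two points in a common cell or row are each bounded by \<open>cell_bound\<close> of the
  other, so in a spread set neither can lie strictly before the other.\<close>

lemma spread_cell_bound_imp_thin:
  assumes "spread cell_bound A"
  shows "thin A"
proof -
  have *: "x = y" if "x \<in> A" "y \<in> A" "x \<le> cell_bound y" "y \<le> cell_bound x" for x y
    using assms that unfolding spread_def by (metis linorder_neqE_nat not_le)
  have "x = y" if "x \<in> A \<inter> cell c" "y \<in> A \<inter> cell c" for x y c
    using that by (intro *) (auto intro: cell_bound_ge(3) cell_ge)
  moreover have "x = y" if "x \<in> A \<inter> row n k" "y \<in> A \<inter> row n k" for x y n k
    using that by (intro *) (auto intro: cell_bound_ge(2) row_ge)
  ultimately show ?thesis
    unfolding thin_def by blast
qed

section \<open>Random selectors\<close>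

text \<open>The number is formed by the first c binary digits of the fractional part of r, so a
  uniform real picks a uniform point of every cell.\<close>

definition selector :: "real \<Rightarrow> nat \<Rightarrow> nat" where
  "selector r c = prod_encode (c, nat (\<lfloor>r * 2 ^ c\<rfloor> mod 2 ^ c))"

lemma selector_in_cell: "selector r c \<in> cell c"
proof -
  have "nat (\<lfloor>r * 2 ^ c\<rfloor> mod 2 ^ c) < 2 ^ c"
    by (simp add: nat_less_iff)
  then show ?thesis
    by (auto simp: selector_def cell_def)
qed

lemma selector_eq_imp_close:
  assumes "selector r c = selector r' c" "\<lfloor>r\<rfloor> = \<lfloor>r'\<rfloor>"
  shows "\<bar>r - r'\<bar> \<le> 1 / 2 ^ c"
proof -
  have div: "\<lfloor>r * 2 ^ c\<rfloor> div 2 ^ c = \<lfloor>r\<rfloor>" for r :: real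
    using floor_divide_real_eq_div[of "2 ^ c" "r * 2 ^ c"] by simp
  have "\<lfloor>r * 2 ^ c\<rfloor> mod 2 ^ c = \<lfloor>r' * 2 ^ c\<rfloor> mod 2 ^ c"
    using assms(1) by (simp add: selector_def eq_nat_nat_iff)
  then have "\<lfloor>r * 2 ^ c\<rfloor> = \<lfloor>r' * 2 ^ c\<rfloor>"
    using div assms(2) by (metis div_mult_mod_eq)
  then have "\<bar>r * 2 ^ c - r' * 2 ^ c\<bar> \<le> 1"
    by linarith
  then have "\<bar>r - r'\<bar> * 2 ^ c \<le> 1"
    by (simp add: abs_mult flip: left_diff_distrib)
  then show ?thesis
    by (simp add: field_simps)
qed

text \<open>Among reals with fixed integer part z, selecting the only possible point of A in
  \<open>cell c\<close> confines r to an interval of length \<open>2 / 2 ^ c\<close>. These lengths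
  are summable, so Borel-Cantelli applies; then z runs through countably many values.\<close>

lemma null_selector_infinitely_often:
  assumes "\<And>c x y. x \<in> A \<Longrightarrow> y \<in> A \<Longrightarrow> x \<in> cell c \<Longrightarrow> y \<in> cell c \<Longrightarrow> x = y"
  shows "{r. infinite {c. selector r c \<in> A}} \<in> null_sets lebesgue"
proof -
  have "{r. \<lfloor>r\<rfloor> = z \<and> infinite {c. selector r c \<in> A}} \<in> null_sets lebesgue" for z
  proof -
    define U where "U c = {r. \<lfloor>r\<rfloor> = z \<and> selector r c \<in> A}" for c
    have "\<exists>a. U c \<subseteq> {a - 1 / 2 ^ c .. a + 1 / 2 ^ c}" for c
    proof (cases "U c = {}")
      case False
      then obtain a where "a \<in> U c" by blast
      have "\<bar>r - a\<bar> \<le> 1 / 2 ^ c" if "r \<in> U c" for r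
        using assms[OF _ _ selector_in_cell selector_in_cell] that \<open>a \<in> U c\<close>
        by (intro selector_eq_imp_close) (auto simp: U_def)
      then have "U c \<subseteq> {a - 1 / 2 ^ c .. a + 1 / 2 ^ c}"
        by (force simp: abs_le_iff)
      then show ?thesis ..
    qed simp
    then obtain a where a: "\<And>c. U c \<subseteq> {a c - 1 / 2 ^ c .. a c + 1 / 2 ^ c}"
      by metis
    define I where "I c = {a c - 1 / 2 ^ c .. a c + 1 / 2 ^ c}" for c
    have measure_I: "measure lebesgue (I c) = 2 * (1 / 2) ^ c" for c
      by (simp add: I_def power_divide)
    have "limsup I \<in> null_sets lebesgue"
    proof (rule borel_cantelli_limsup1)
      show "emeasure lebesgue (I c) < \<infinity>" for c
        by (simp add: I_def)
      show "summable (\<lambda>c. measure lebesgue (I c))"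
        unfolding measure_I by (intro summable_mult summable_geometric) simp
    qed (simp add: I_def)
    moreover have "{r. \<lfloor>r\<rfloor> = z \<and> infinite {c. selector r c \<in> A}} \<subseteq> limsup I"
    proof
      fix r assume r: "r \<in> {r. \<lfloor>r\<rfloor> = z \<and> infinite {c. selector r c \<in> A}}"
      then have "\<exists>\<^sub>F c in sequentially. r \<in> U c"
        by (simp add: U_def frequently_cofinite flip: cofinite_eq_sequentially)
      then show "r \<in> limsup I"
        unfolding mem_limsup_iff I_def using a by (elim frequently_elim1) blast
    qed
    ultimately show ?thesis
      using negligible_subset by (auto simp flip: negligible_iff_null_sets)
  qed
  then have "(\<Union>z. {r. \<lfloor>r\<rfloor> = z \<and> infinite {c. selector r c \<in> A}}) \<in> null_sets lebesgue"
    by (rule null_sets_UN)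
  moreover have "{r. infinite {c. selector r c \<in> A}} = (\<Union>z. {r. \<lfloor>r\<rfloor> = z \<and> infinite {c. selector r c \<in> A}})"
    by auto
  ultimately show ?thesis
    by simp
qed

text \<open>Every thin set excludes a null set of reals, and fewer than continuum many null sets
  leave some real r, whose digits give the selector.\<close>

lemma almost_disjoint_selector:
  assumes "covN_eq_c" "below_continuum \<A>" "\<And>A. A \<in> \<A> \<Longrightarrow> thin A"
  obtains s where "\<And>c. s c \<in> cell c" "\<And>A. A \<in> \<A> \<Longrightarrow> finite {c. s c \<in> A}"
proof -
  define N where "N A = {r. infinite {c. selector r c \<in> A}}" for A
  have "N A \<in> null_sets lebesgue" if "A \<in> \<A>" for A
    unfolding N_def using thin_cellD[OF assms(3)[OF that]]
    by (intro null_selector_infinitely_often)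
  then obtain r where "\<And>X. X \<in> N ` \<A> \<Longrightarrow> r \<notin> X"
    using null_sets_below_continuum_not_cover[OF assms(1) below_continuum_image[OF assms(2)], of N]
    by (metis image_subsetI)
  then show thesis
    using that[of "selector r"] selector_in_cell unfolding N_def by auto
qed

text \<open>The condition by which A codes f: a set disjoint from A contains no cell of
  \<open>row n k\<close> with k < f n.\<close>

definition meets_rows :: "(nat \<Rightarrow> nat) \<Rightarrow> nat set \<Rightarrow> bool" where
  "meets_rows f A \<longleftrightarrow> (\<forall>n. \<forall>k<f n. \<forall>l\<le>k. A \<inter> cell (cell_index n k l) \<noteq> {})"

lemma exists_thin_meeting_rows:
  assumes "covN_eq_c" "below_continuum \<A>" "\<And>A. A \<in> \<A> \<Longrightarrow> thin A"
  obtains B where "infinite B" "thin B" "\<And>A. A \<in> \<A> \<Longrightarrow> finite (A \<inter> B)" "meets_rows f B"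
proof -
  obtain s where s: "\<And>c. s c \<in> cell c" "\<And>A. A \<in> \<A> \<Longrightarrow> finite {c. s c \<in> A}"
    using almost_disjoint_selector[OF assms] by blast
  \<comment> \<open>The bound is k \<le> f n rather than k < f n so that J is infinite even when f
    vanishes: the single cell of \<open>row n 0\<close> is present for every n. Rows with k > f n
    are missed, which yields thinness.\<close>
  define J where "J = {cell_index n k l |n k l. k \<le> f n \<and> l \<le> k}"
  have inj: "inj s"
    using s(1) cell_disjoint by (metis injI)
  have "range (\<lambda>n. cell_index n 0 0) \<subseteq> J"
    unfolding J_def by blast
  moreover have "infinite (range (\<lambda>n. cell_index n 0 0))"
    by (intro range_inj_infinite injI) simp
  ultimately have "infinite (s ` J)"
    using inj by (metis finite_imageD finite_subset inj_on_subset subset_UNIV)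
  moreover have "thin (s ` J)"
  proof -
    have "k \<le> f n" if "x \<in> s ` J" "x \<in> row n k" for x n k
    proof -
      obtain n' k' l' where x: "x = s (cell_index n' k' l')" "k' \<le> f n'"
        using \<open>x \<in> s ` J\<close> unfolding J_def by blast
      moreover obtain l where "x \<in> cell (cell_index n k l)"
        using \<open>x \<in> row n k\<close> unfolding row_def by blast
      ultimately have "cell_index n' k' l' = cell_index n k l"
        using s(1) cell_disjoint by blast
      then show ?thesis
        using x by simp
    qed
    then have "s ` J \<inter> row n k = {}" if "Suc (f n) \<le> k" for n k
      using that by fastforce
    moreover have "x = y" if "x \<in> s ` J \<inter> cell c" "y \<in> s ` J \<inter> cell c" for x y c
      using that s(1) cell_disjoint by (metis IntE imageE)
    ultimately show ?thesis
      unfolding thin_def by (metis empty_iff)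
  qed
  moreover have "finite (A \<inter> s ` J)" if "A \<in> \<A>" for A
    by (rule finite_subset[of _ "s ` {c. s c \<in> A}"]) (auto simp: s(2)[OF that])
  moreover have "meets_rows f (s ` J)"
  proof -
    have "s (cell_index n k l) \<in> s ` J \<inter> cell (cell_index n k l)" if "k < f n" "l \<le> k" for n k l
      using that s(1) unfolding J_def by (force intro: less_imp_le)
    then show ?thesis
      unfolding meets_rows_def by blast
  qed
  ultimately show thesis
    using that by blast
qed

section \<open>Spread sets meeting countably many positive sets\<close>

lemma set_decode_le:
  assumes "x \<in> set_decode c"
  shows "x \<le> c"
proof -
  have "2 ^ x \<le> c"
    using assms by (auto simp: set_decode_def not_less[symmetric] intro!: notI)
  then show ?thesis
    using less_exp[of x] by linarith
qed

text \<open>By induction on j, a point of \<open>Y j - Z\<close> is added beyond all earlier points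
  and all their h-values; sums serve as a bound for these.\<close>

lemma finite_spread_meeting:
  fixes Y :: "nat \<Rightarrow> nat set"
  assumes "\<And>i. infinite (Y i - Z)"
  shows "\<exists>s. finite s \<and> s \<inter> Z = {} \<and> (\<forall>x\<in>s. m \<le> x) \<and> (\<forall>i<j. s \<inter> Y i \<noteq> {}) \<and> spread h s"
proof (induction j)
  case 0
  show ?case
    by (intro exI[of _ "{}"]) (simp add: spread_def)
next
  case (Suc j)
  then obtain s where s: "finite s" "s \<inter> Z = {}" "\<forall>x\<in>s. m \<le> x" "\<forall>i<j. s \<inter> Y i \<noteq> {}" "spread h s"
    by blast
  obtain y where y: "y \<in> Y j - Z" "m + \<Sum>s + sum h s < y"
    using assms[of j] by (meson infinite_nat_iff_unbounded)
  have "x < y \<and> h x < y" if "x \<in> s" for x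
    using member_le_sum[OF that, of h] member_le_sum[OF that, of id] s(1) y(2) by simp
  then have "spread h (insert y s)"
    using s(5) unfolding spread_def by (metis insert_iff not_less_iff_gr_or_eq)
  moreover have "\<forall>i<Suc j. insert y s \<inter> Y i \<noteq> {}"
    using s(4) y(1) by (auto simp: less_Suc_eq)
  ultimately show ?case
    using s(1-3) y by (intro exI[of _ "insert y s"]) auto
qed

lemma exists_spread_meeting_positive_sets:
  fixes Y :: "nat \<Rightarrow> nat set"
  assumes "p_eq_c" "below_continuum \<A>"
    and pos: "\<And>i \<C>. \<C> \<subseteq> \<A> \<Longrightarrow> finite \<C> \<Longrightarrow> infinite (Y i - \<Union>\<C>)"
    and h: "mono h" "\<And>x. x \<le> h x"
  obtains B where "\<And>i. infinite (B \<inter> Y i)" "\<And>A. A \<in> \<A> \<Longrightarrow> finite (A \<inter> B)" "spread h B"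
proof -
  \<comment> \<open>Numbers code finite blocks through \<open>set_decode\<close>. \<open>S A\<close>
    collects the blocks avoiding A, \<open>E k\<close> the h-spread blocks with all points at least
    k that meet \<open>Y 0\<close>, ..., \<open>Y k\<close>. In a pseudointersection almost all
    blocks have each of these properties.\<close>
  define S where "S A = {c. set_decode c \<inter> A = {}}" for A
  define E where "E k = {c. (\<forall>x\<in>set_decode c. k \<le> x) \<and> (\<forall>i\<le>k. set_decode c \<inter> Y i \<noteq> {}) \<and>
    spread h (set_decode c)}" for k
  have E_antimono: "E k' \<subseteq> E k" if "k \<le> k'" for k k'
    using that le_trans unfolding E_def by blast
  have E_ge: "k \<le> c" if "c \<in> E k" for c k
  proof -
    obtain x where "x \<in> set_decode c" "k \<le> x"
      using \<open>c \<in> E k\<close> unfolding E_def by blast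
    then show ?thesis
      using set_decode_le le_trans by blast
  qed
  have inf: "infinite ((\<Inter>A\<in>\<C>. S A) \<inter> E k)" if \<C>: "\<C> \<subseteq> \<A>" "finite \<C>" for \<C> k
    unfolding infinite_nat_iff_unbounded_le
  proof
    fix m
    obtain s where s: "finite s" "s \<inter> \<Union>\<C> = {}" "\<forall>x\<in>s. max m k \<le> x"
      "\<forall>i<Suc (max m k). s \<inter> Y i \<noteq> {}" "spread h s"
      using finite_spread_meeting[of Y "\<Union>\<C>" "max m k" "Suc (max m k)" h, OF pos[OF \<C>]] by blast
    then have "set_encode s \<in> E (max m k)"
      unfolding E_def by (simp add: less_Suc_eq_le)
    moreover have "set_encode s \<in> (\<Inter>A\<in>\<C>. S A)"
      using s(1,2) unfolding S_def by auto
    ultimately show "\<exists>c\<ge>m. c \<in> (\<Inter>A\<in>\<C>. S A) \<inter> E k"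
      using E_ge E_antimono by (meson IntI max.bounded_iff max.cobounded2 subsetD)
  qed
  define \<X> where "\<X> = S ` \<A> \<union> range E"
  have "sfip \<X>"
    unfolding sfip_def
  proof (intro allI impI)
    fix \<Y> assume \<Y>: "\<Y> \<subseteq> \<X> \<and> finite \<Y> \<and> \<Y> \<noteq> {}"
    obtain \<C> where \<C>: "\<C> \<subseteq> \<A>" "finite \<C>" "\<Y> \<inter> S ` \<A> = S ` \<C>"
      using finite_subset_image[of "\<Y> \<inter> S ` \<A>" S \<A>] \<Y> by auto
    obtain D where D: "finite D" "\<Y> \<inter> range E = E ` D"
      using finite_subset_image[of "\<Y> \<inter> range E" E UNIV] \<Y> by auto
    \<comment> \<open>The sets \<open>E k\<close> decrease, so the one with index \<Sum>D lies in
      all those with index in D.\<close>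
    have "(\<Inter>A\<in>\<C>. S A) \<inter> E (\<Sum>D) \<subseteq> X" if "X \<in> \<Y>" for X
    proof (cases "X \<in> S ` \<A>")
      case True
      then show ?thesis
        using \<C> that by blast
    next
      case False
      then have "X \<in> E ` D"
        using D that \<Y> unfolding \<X>_def by blast
      then show ?thesis
        using E_antimono member_le_sum[of _ D id] D(1) by fastforce
    qed
    then have "(\<Inter>A\<in>\<C>. S A) \<inter> E (\<Sum>D) \<subseteq> \<Inter>\<Y>"
      by blast
    then show "infinite (\<Inter>\<Y>)"
      using inf[OF \<C>(1,2)] finite_subset by blast
  qed
  moreover have "infinite X" if "X \<in> \<X>" for X
    using \<open>sfip \<X>\<close> that unfolding sfip_def by (elim allE[of _ "{X}"]) auto
  moreover have "below_continuum \<X>"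
    unfolding \<X>_def
    by (intro below_continuum_Un below_continuum_image below_continuum_range_nat assms(2))
  ultimately obtain P where P: "infinite P" "\<And>X. X \<in> \<X> \<Longrightarrow> finite (P - X)"
    using pseudointersection_below_continuum[OF assms(1)] by blast
  have ex: "\<exists>c. c \<in> P \<inter> E k" for k
  proof -
    have "finite (P - E k)"
      using P(2) unfolding \<X>_def by blast
    then show ?thesis
      using P(1) by (metis Diff_triv all_not_in_conv)
  qed
  \<comment> \<open>All points of the next block exceed the h-value of the code \<open>c j\<close>,
    and this code bounds the points of its own block. As h is monotone, the union of the blocks is
    again h-spread.\<close>
  have "\<exists>c. \<forall>j. c j \<in> P \<inter> E j \<and> c (Suc j) \<in> E (Suc (h (c j)))"
  proof (rule dependent_nat_choice)
    show "\<exists>c. c \<in> P \<inter> E 0"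
      by (rule ex)
    show "\<exists>c'. c' \<in> P \<inter> E (Suc j) \<and> c' \<in> E (Suc (h c))" for c j
      using ex[of "max (Suc j) (Suc (h c))"] E_antimono
      by (meson IntE IntI max.cobounded1 max.cobounded2 subsetD)
  qed
  then obtain c where c: "\<And>j. c j \<in> P" "\<And>j. c j \<in> E j" "\<And>j. c (Suc j) \<in> E (Suc (h (c j)))"
    by blast
  have "c j < c (Suc j)" for j
    using E_ge[OF c(3)[of j]] h(2)[of "c j"] by linarith
  then have c_mono: "strict_mono c"
    by (simp add: strict_mono_Suc_iff)
  define B where "B = (\<Union>j. set_decode (c j))"
  have "infinite (B \<inter> Y i)" for i
    unfolding infinite_nat_iff_unbounded_le
  proof
    fix m
    have "set_decode (c (m + i)) \<inter> Y i \<noteq> {}" and ge: "\<forall>x\<in>set_decode (c (m + i)). m + i \<le> x"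
      using c(2)[of "m + i"] unfolding E_def by simp_all
    then obtain x where "x \<in> set_decode (c (m + i))" "x \<in> Y i"
      by blast
    moreover from this have "m \<le> x"
      using ge by (meson add_leD1)
    ultimately show "\<exists>x\<ge>m. x \<in> B \<inter> Y i"
      unfolding B_def by blast
  qed
  \<comment> \<open>A block meeting A has its code outside \<open>S A\<close>, and P has only
    finitely many such codes.\<close>
  moreover have "finite (A \<inter> B)" if "A \<in> \<A>" for A
  proof (rule finite_subset)
    have "finite (P - S A)"
      using P(2) that unfolding \<X>_def by blast
    then show "finite (\<Union> (set_decode ` (P - S A)))"
      by simp
    show "A \<inter> B \<subseteq> \<Union> (set_decode ` (P - S A))"
      using c(1) unfolding B_def S_def by blast
  qed
  moreover have "spread h B"
    unfolding spread_def
  proof (intro ballI impI)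
    fix x y assume "x \<in> B" "y \<in> B" "x < y"
    then obtain i j where ij: "x \<in> set_decode (c i)" "y \<in> set_decode (c j)"
      unfolding B_def by blast
    have *: "h u < v" if "u \<in> set_decode (c i)" "v \<in> set_decode (c j)" "i < j" for u v i j
    proof -
      obtain j' where j': "j = Suc j'" "i \<le> j'"
        using \<open>i < j\<close> by (metis Suc_le_eq less_Suc_eq_le not0_implies_Suc not_less0)
      have "u \<le> c j'"
        using set_decode_le[OF that(1)] c_mono j'(2) by (meson le_trans strict_mono_less_eq)
      then have "h u \<le> h (c j')"
        using h(1) by (simp add: monoD)
      moreover have "Suc (h (c j')) \<le> v"
        using c(3)[of j'] that(2) unfolding E_def j'(1) by blast
      ultimately show ?thesis
        by simp
    qed
    consider "i = j" | "i < j" | "j < i"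
      by linarith
    then show "h x < y"
    proof cases
      case 1
      then show ?thesis
        using c(2)[of j] ij \<open>x < y\<close> unfolding E_def spread_def by blast
    next
      case 2
      then show ?thesis
        using * ij by blast
    next
      \<comment> \<open>This case is contradictory: y in an earlier block would give h y < x,
        against x < y \<le> h y.\<close>
      case 3
      then show ?thesis
        using *[OF ij(2,1)] h(2)[of y] \<open>x < y\<close> by linarith
    qed
  qed
  ultimately show thesis
    using that by blast
qed

section \<open>Cohen names\<close>

lemma cohen_le_refl: "cohen_le p p"
  by (simp add: cohen_le_def)

lemma cohen_le_trans: "cohen_le r q \<Longrightarrow> cohen_le q p \<Longrightarrow> cohen_le r p"
  by (auto simp: cohen_le_def)

text \<open>A ground-model hull of the named set: q forces the named set to be contained in
  it.\<close>

definition cohen_possible :: "(nat \<Rightarrow> bool list set) \<Rightarrow> bool list \<Rightarrow> nat set" where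
  "cohen_possible \<sigma> q = {n. \<exists>r. cohen_le r q \<and> forces_meets UNIV cohen_le (\<sigma> n) r}"

text \<open>Below any q the set A contains arbitrarily large possible values, and some extension of
  q forces one of them into the named set.\<close>

lemma cohen_forces_inf_interI:
  assumes "\<And>q. cohen_le q p \<Longrightarrow> infinite (A \<inter> cohen_possible \<sigma> q)"
  shows "forces_inf_inter UNIV cohen_le \<sigma> A p"
  unfolding forces_inf_inter_def
proof (intro allI ballI impI)
  fix k q assume "cohen_le q p"
  then obtain n where "k \<le> n" "n \<in> A \<inter> cohen_possible \<sigma> q"
    using assms by (meson infinite_nat_iff_unbounded_le)
  then show "\<exists>r\<in>UNIV. cohen_le r q \<and> (\<exists>n\<in>A. k \<le> n \<and> forces_meets UNIV cohen_le (\<sigma> n) r)"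
    unfolding cohen_possible_def by blast
qed

text \<open>Otherwise p could be extended once for each member of \<C>, each time bounding the
  intersection of the named set with that member. As the possible values are almost covered by \<C>,
  the named set would become finite.\<close>

lemma cohen_forces_inf_inter_finite_cover:
  assumes "forces_inf UNIV cohen_le \<sigma> p" "finite \<C>" "finite (cohen_possible \<sigma> p - \<Union>\<C>)"
  obtains A q where "A \<in> \<C>" "cohen_le q p" "forces_inf_inter UNIV cohen_le \<sigma> A q"
proof (rule ccontr)
  assume "\<not> thesis"
  then have no: "\<not> forces_inf_inter UNIV cohen_le \<sigma> A q" if "A \<in> \<C>" "cohen_le q p" for A q
    using that \<open>\<And>A q. A \<in> \<C> \<Longrightarrow> cohen_le q p \<Longrightarrow> forces_inf_inter UNIV cohen_le \<sigma> A q \<Longrightarrow> thesis\<close>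
    by blast
  have avoid: "\<exists>q k. cohen_le q p \<and> (\<forall>A\<in>\<D>. \<forall>r n. cohen_le r q \<longrightarrow> n \<in> A \<longrightarrow> k \<le> n \<longrightarrow>
      \<not> forces_meets UNIV cohen_le (\<sigma> n) r)" if "\<D> \<subseteq> \<C>" for \<D>
    using finite_subset[OF that assms(2)] that
  proof (induction \<D> rule: finite_induct)
    case empty
    show ?case
      using cohen_le_refl by blast
  next
    case (insert A \<D>)
    then obtain q k where q: "cohen_le q p"
      "\<forall>A\<in>\<D>. \<forall>r n. cohen_le r q \<longrightarrow> n \<in> A \<longrightarrow> k \<le> n \<longrightarrow> \<not> forces_meets UNIV cohen_le (\<sigma> n) r"
      by blast
    obtain q' k' where q': "cohen_le q' q"
      "\<forall>r n. cohen_le r q' \<longrightarrow> n \<in> A \<longrightarrow> k' \<le> n \<longrightarrow> \<not> forces_meets UNIV cohen_le (\<sigma> n) r"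
      using no[OF _ q(1), of A] insert.prems unfolding forces_inf_inter_def by blast
    show ?case
    proof (intro exI[of _ q'] exI[of _ "max k k'"] conjI ballI allI impI)
      show "cohen_le q' p"
        using q'(1) q(1) cohen_le_trans by blast
      show "\<not> forces_meets UNIV cohen_le (\<sigma> n) r"
        if "A' \<in> insert A \<D>" "cohen_le r q'" "n \<in> A'" "max k k' \<le> n" for A' r n
      proof (cases "A' = A")
        case True
        then show ?thesis
          using that q'(2) by simp
      next
        case False
        moreover have "cohen_le r q"
          using that(2) q'(1) cohen_le_trans by blast
        ultimately show ?thesis
          using that q(2) by auto
      qed
    qed
  qed
  obtain q k where q: "cohen_le q p"
    "\<forall>A\<in>\<C>. \<forall>r n. cohen_le r q \<longrightarrow> n \<in> A \<longrightarrow> k \<le> n \<longrightarrow> \<not> forces_meets UNIV cohen_le (\<sigma> n) r"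
    using avoid[OF order_refl] by blast
  obtain m where m: "\<forall>n\<in>cohen_possible \<sigma> p - \<Union>\<C>. n < m"
    using assms(3) finite_nat_set_iff_bounded by blast
  obtain r n where r: "cohen_le r q" "max k m \<le> n" "forces_meets UNIV cohen_le (\<sigma> n) r"
    using assms(1) q(1) unfolding forces_inf_def forces_inf_inter_def by blast
  then have "n \<in> cohen_possible \<sigma> p"
    using q(1) cohen_le_trans unfolding cohen_possible_def by blast
  then have "n \<in> \<Union>\<C>"
    using m r(2) by (metis DiffI max.bounded_iff not_less)
  then show False
    using q(2) r by auto
qed

text \<open>Maximality is applied to the canonical name of B, with \<open>\<sigma> n\<close>
  everything or nothing.\<close>

lemma forces_maximal_cohen_imp_maximal:
  assumes "forces_maximal UNIV cohen_le \<A>" "infinite B"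
  obtains A where "A \<in> \<A>" "infinite (B \<inter> A)"
proof -
  define \<sigma> :: "nat \<Rightarrow> bool list set" where "\<sigma> n = (if n \<in> B then UNIV else {})" for n
  have meets: "forces_meets UNIV cohen_le (\<sigma> n) r \<longleftrightarrow> n \<in> B" for n r
    unfolding forces_meets_def \<sigma>_def using cohen_le_refl by auto
  have "forces_inf UNIV cohen_le \<sigma> []"
    unfolding forces_inf_def forces_inf_inter_def meets
    using assms(2) cohen_le_refl by (meson UNIV_I infinite_nat_iff_unbounded_le)
  then obtain A q where A: "A \<in> \<A>" "forces_inf_inter UNIV cohen_le \<sigma> A q"
    using assms(1) unfolding forces_maximal_def by blast
  have "\<exists>n\<ge>k. n \<in> B \<inter> A" for k
    using A(2) cohen_le_refl unfolding forces_inf_inter_def meets by blast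
  then show thesis
    using that[OF A(1)] by (simp add: infinite_nat_iff_unbounded_le)
qed

section \<open>The recursion\<close>

definition thin_ad_family :: "nat set set \<Rightarrow> bool" where
  "thin_ad_family \<A> \<longleftrightarrow> (\<forall>A\<in>\<A>. infinite A \<and> thin A) \<and>
     (\<forall>A\<in>\<A>. \<forall>B\<in>\<A>. A \<noteq> B \<longrightarrow> finite (A \<inter> B))"

lemma thin_ad_family_insert:
  assumes "thin_ad_family \<A>" "infinite B" "thin B" "\<And>A. A \<in> \<A> \<Longrightarrow> finite (A \<inter> B)"
  shows "thin_ad_family (insert B \<A>)"
  using assms unfolding thin_ad_family_def by (metis Int_commute insert_iff)

type_synonym task = "((nat \<Rightarrow> bool list set) \<times> bool list) + (nat \<Rightarrow> nat)"

fun fulfils :: "nat set set \<Rightarrow> task \<Rightarrow> bool" where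
  "fulfils \<A> (Inl (\<sigma>, p)) \<longleftrightarrow> (forces_inf UNIV cohen_le \<sigma> p \<longrightarrow>
     (\<exists>q. cohen_le q p \<and> (\<exists>A\<in>\<A>. forces_inf_inter UNIV cohen_le \<sigma> A q)))"
| "fulfils \<A> (Inr f) \<longleftrightarrow> (\<exists>A\<in>\<A>. meets_rows f A)"

lemma fulfils_mono: "fulfils \<A> t \<Longrightarrow> \<A> \<subseteq> \<B> \<Longrightarrow> fulfils \<B> t"
  by (cases "(\<A>, t)" rule: fulfils.cases) auto

lemma fulfil_task:
  assumes "p_eq_c" "covN_eq_c" "below_continuum \<A>" "thin_ad_family \<A>"
  shows "\<exists>B. thin_ad_family (insert B \<A>) \<and> fulfils (insert B \<A>) t"
proof -
  have rows: "\<exists>B. thin_ad_family (insert B \<A>) \<and> meets_rows f B" for f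
  proof -
    obtain B where "infinite B" "thin B" "\<And>A. A \<in> \<A> \<Longrightarrow> finite (A \<inter> B)" "meets_rows f B"
      using exists_thin_meeting_rows[OF assms(2,3)] assms(4) unfolding thin_ad_family_def by metis
    then show ?thesis
      using thin_ad_family_insert[OF assms(4)] by blast
  qed
  show ?thesis
  proof (cases t)
    case (Inr f)
    then show ?thesis
      using rows[of f] by auto
  next
    case (Inl \<sigma>p)
    obtain \<sigma> p where t: "t = Inl (\<sigma>, p)"
      using Inl by (cases \<sigma>p) auto
    show ?thesis
    proof (cases "fulfils \<A> t")
      \<comment> \<open>The task is done already, but some B must still be supplied; any set given
        by \<open>rows\<close> keeps the family thin and almost disjoint.\<close>
      case True
      then show ?thesis
        using rows fulfils_mono by blast
    next
      case False
      then have inf: "forces_inf UNIV cohen_le \<sigma> p"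
        and no: "\<And>q A. cohen_le q p \<Longrightarrow> A \<in> \<A> \<Longrightarrow> \<not> forces_inf_inter UNIV cohen_le \<sigma> A q"
        unfolding t by auto
      \<comment> \<open>Every condition below p is p followed by a list, and \<open>from_nat\<close>
        enumerates all lists, so Y runs through the sets of possible values of all conditions below
        p.\<close>
      define Y where "Y i = cohen_possible \<sigma> (p @ from_nat i)" for i
      have "infinite (Y i - \<Union>\<C>)" if \<C>: "\<C> \<subseteq> \<A>" "finite \<C>" for i \<C>
      proof
        assume fin: "finite (Y i - \<Union>\<C>)"
        have le: "cohen_le (p @ from_nat i) p"
          by (simp add: cohen_le_def)
        then have "forces_inf UNIV cohen_le \<sigma> (p @ from_nat i)"
          using inf cohen_le_trans unfolding forces_inf_def forces_inf_inter_def by blast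
        then obtain A q where "A \<in> \<C>" "cohen_le q (p @ from_nat i)"
          "forces_inf_inter UNIV cohen_le \<sigma> A q"
          using cohen_forces_inf_inter_finite_cover[OF _ \<C>(2)] fin unfolding Y_def by blast
        then show False
          using no le cohen_le_trans \<C>(1) by blast
      qed
      then obtain B where B: "\<And>i. infinite (B \<inter> Y i)" "\<And>A. A \<in> \<A> \<Longrightarrow> finite (A \<inter> B)"
        "spread cell_bound B"
        using exists_spread_meeting_positive_sets[OF assms(1,3) _ mono_cell_bound cell_bound_ge(1)]
        by metis
      have "forces_inf_inter UNIV cohen_le \<sigma> B p"
      proof (rule cohen_forces_inf_interI)
        fix q assume "cohen_le q p"
        then obtain r where "q = p @ r"
          unfolding cohen_le_def by blast
        then show "infinite (B \<inter> cohen_possible \<sigma> q)"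
          using B(1)[of "to_nat r"] unfolding Y_def by simp
      qed
      then have "fulfils (insert B \<A>) t"
        using cohen_le_refl unfolding t by auto
      moreover have "infinite B"
        using B(1) finite_Int by blast
      ultimately show ?thesis
        using thin_ad_family_insert[OF assms(4)] spread_cell_bound_imp_thin B by blast
    qed
  qed
qed

text \<open>A task is coded by a subset of one countable type: the graph of the name together with
  the condition, or the graph of f. The mark \<open>Inr (Inl p)\<close> recovers p and separates the
  two kinds.\<close>

lemma exists_task_enumeration: "\<exists>e :: nat set \<Rightarrow> task. surj e"
proof -
  define code :: "task \<Rightarrow> (nat \<times> bool list + bool list + nat \<times> nat) set" where
    "code t = (case t of
        Inl (\<sigma>, p) \<Rightarrow> insert (Inr (Inl p)) {Inl (n, q) |n q. q \<in> \<sigma> n}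
      | Inr f \<Rightarrow> {Inr (Inr (n, f n)) |n. True})" for t
  have "inj code"
  proof (rule injI)
    fix t t' assume eq: "code t = code t'"
    have member: "\<And>x. x \<in> code t \<longleftrightarrow> x \<in> code t'"
      by (simp add: eq)
    consider (ll) \<sigma> p \<sigma>' p' where "t = Inl (\<sigma>, p)" "t' = Inl (\<sigma>', p')"
      | (lr) \<sigma> p f where "t = Inl (\<sigma>, p)" "t' = Inr f"
      | (rl) \<sigma> p f where "t = Inr f" "t' = Inl (\<sigma>, p)"
      | (rr) f f' where "t = Inr f" "t' = Inr f'"
      by (metis sumE surj_pair)
    then show "t = t'"
    proof cases
      case ll
      have "q \<in> \<sigma> n \<longleftrightarrow> q \<in> \<sigma>' n" for n q
        using member[of "Inl (n, q)"] by (simp add: ll code_def)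
      then have "\<sigma> = \<sigma>'"
        by blast
      moreover have "p = p'"
        using member[of "Inr (Inl p)"] by (simp add: ll code_def)
      ultimately show ?thesis
        by (simp add: ll)
    next
      case lr
      then show ?thesis
        using member[of "Inr (Inl p)"] by (simp add: code_def)
    next
      case rl
      then show ?thesis
        using member[of "Inr (Inl p)"] by (simp add: code_def)
    next
      case rr
      have "f n = f' n" for n
        using member[of "Inr (Inr (n, f n))"] by (simp add: rr code_def)
      then show ?thesis
        by (auto simp: rr)
    qed
  qed
  then have "inj (\<lambda>t. to_nat ` code t)"
    by (simp add: inj_def inj_image_eq_iff)
  then show ?thesis
    using inj_imp_surj_inv by blast
qed

lemma exists_thin_ad_family_fulfilling:
  assumes "p_eq_c" "covN_eq_c"
  obtains \<A> where "thin_ad_family \<A>" "\<And>t. fulfils \<A> t"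
proof -
  obtain e :: "nat set \<Rightarrow> task" where "surj e"
    using exists_task_enumeration by blast
  \<comment> \<open>A cardinal order has proper initial segments of smaller cardinality, so
    \<open>fulfil_task\<close> applies at each stage of the recursion.\<close>
  define r where "r = card_of (UNIV :: nat set set)"
  have card: "Card_order r"
    unfolding r_def by (rule card_of_Card_order)
  have field: "Field r = UNIV"
    unfolding r_def by (rule Field_card_of)
  have wo: "Well_order r"
    using card unfolding card_order_on_def by simp
  have total: "y \<in> underS r y' \<or> y' \<in> underS r y" if "y \<noteq> y'" for y y'
    using wo that field
    unfolding well_order_on_def linear_order_on_def total_on_def underS_def by auto
  define good where "good h x B \<longleftrightarrow> thin_ad_family (insert B (h ` underS r x)) \<and>
    fulfils (insert B (h ` underS r x)) (e x)" for h x B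
  \<comment> \<open>Two distinct members occur together at the later of their stages. The set U is
    an initial segment during the recursion and the whole index set at the end.\<close>
  have family: "thin_ad_family (h ` U)" if "\<And>x. x \<in> U \<Longrightarrow> good h x (h x)" for h U
    unfolding thin_ad_family_def
  proof (intro conjI ballI impI)
    fix A assume "A \<in> h ` U"
    then show "infinite A" "thin A"
      using that unfolding good_def thin_ad_family_def by blast+
  next
    fix A B assume AB: "A \<in> h ` U" "B \<in> h ` U" "A \<noteq> B"
    then obtain y y' where y: "A = h y" "B = h y'" "y \<in> U" "y' \<in> U" "y \<noteq> y'"
      by blast
    have ad: "finite (h u \<inter> h v)" if "u \<in> underS r v" "v \<in> U" "h u \<noteq> h v" for u v
    proof -
      have "thin_ad_family (insert (h v) (h ` underS r v))"
        using \<open>v \<in> U\<close> \<open>\<And>x. x \<in> U \<Longrightarrow> good h x (h x)\<close> unfolding good_def by blast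
      then show ?thesis
        using that(1,3) unfolding thin_ad_family_def by simp
    qed
    show "finite (A \<inter> B)"
      using total[OF y(5)] ad[of y y'] ad[of y' y] y AB(3) by (auto simp: Int_commute)
  qed
  have "\<exists>h. \<forall>x. good h x (h x)"
  proof (rule dependent_wf_choice)
    show "wf (r - Id)"
      using wo unfolding well_order_on_def by simp
  next
    fix h h' :: "nat set \<Rightarrow> nat set" and x B
    assume "\<And>z. (z, x) \<in> r - Id \<Longrightarrow> h z = h' z"
    then have "h ` underS r x = h' ` underS r x"
      unfolding underS_def by (intro image_cong) auto
    then show "good h x B = good h' x B"
      unfolding good_def by simp
  next
    fix x h assume IH: "\<And>y. (y, x) \<in> r - Id \<Longrightarrow> good h y (h y)"
    then have "thin_ad_family (h ` underS r x)"
      by (intro family) (auto simp: underS_def)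
    moreover have "below_continuum (h ` underS r x)"
      using card_of_underS[OF card] field
      by (intro below_continuum_image) (simp add: below_continuum_def r_def)
    ultimately show "\<exists>B. good h x B"
      unfolding good_def using fulfil_task[OF assms] by blast
  qed
  then obtain h where h: "\<And>x. good h x (h x)"
    by blast
  have "fulfils (range h) t" for t
  proof -
    obtain x where "t = e x"
      using \<open>surj e\<close> by blast
    then show ?thesis
      using h[of x] fulfils_mono[of "insert (h x) (h ` underS r x)" t "range h"]
      unfolding good_def by blast
  qed
  then show thesis
    using that family[of UNIV h] h by blast
qed

section \<open>The dominating real\<close>

lemma mathias_le_refl: "mathias_le p p"
  by (simp add: mathias_le_def end_extends_def)

lemma mathias_le_trans: "mathias_le r q \<Longrightarrow> mathias_le q p \<Longrightarrow> mathias_le r p"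
  unfolding mathias_le_def end_extends_def by blast

lemma F_of_Diff_finite:
  assumes "F \<in> F_of \<A>" "finite Z"
  shows "F - Z \<in> F_of \<A>"
proof -
  obtain \<C> where \<C>: "\<C> \<subseteq> \<A>" "finite \<C>" "finite (UNIV - \<Union>\<C> - F)"
    using assms(1) unfolding F_of_def almost_subset_def by blast
  have "UNIV - \<Union>\<C> - (F - Z) \<subseteq> (UNIV - \<Union>\<C> - F) \<union> Z"
    by blast
  then have "finite (UNIV - \<Union>\<C> - (F - Z))"
    using \<C>(3) assms(2) by (meson finite_Un finite_subset)
  then show ?thesis
    using \<C> unfolding F_of_def almost_subset_def by blast
qed

lemma F_of_Diff_member:
  assumes "F \<in> F_of \<A>" "A \<in> \<A>"
  shows "F - A \<in> F_of \<A>"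
proof -
  obtain \<C> where \<C>: "\<C> \<subseteq> \<A>" "finite \<C>" "finite (UNIV - \<Union>\<C> - F)"
    using assms(1) unfolding F_of_def almost_subset_def by blast
  have "UNIV - \<Union>(insert A \<C>) - (F - A) \<subseteq> UNIV - \<Union>\<C> - F"
    by blast
  then have "finite (UNIV - \<Union>(insert A \<C>) - (F - A))"
    using \<C>(3) finite_subset by blast
  then show ?thesis
    unfolding F_of_def almost_subset_def using \<C>(1,2) assms(2)
    by (intro CollectI exI[of _ "insert A \<C>"]) auto
qed

text \<open>F omits only finitely many points, all below m, of the complement of some finite union
  \<Union>\<C>; a cell missed by this union in a row with k \<ge> m has no point below m.\<close>

lemma F_of_contains_cell:
  assumes "\<And>A. A \<in> \<A> \<Longrightarrow> thin A" "F \<in> F_of \<A>"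
  obtains k l where "l \<le> k" "cell (cell_index n k l) \<subseteq> F"
proof -
  obtain \<C> where \<C>: "\<C> \<subseteq> \<A>" "finite \<C>" "finite (UNIV - \<Union>\<C> - F)"
    using assms(2) unfolding F_of_def almost_subset_def by blast
  obtain m where m: "\<forall>x\<in>UNIV - \<Union>\<C> - F. x < m"
    using \<C>(3) finite_nat_set_iff_bounded by blast
  obtain k l where kl: "m \<le> k" "l \<le> k" "cell (cell_index n k l) \<inter> \<Union>\<C> = {}"
    using finite_thin_union_misses_cell[OF \<C>(2)] assms(1) \<C>(1) by (metis subsetD)
  have "x \<in> F" if "x \<in> cell (cell_index n k l)" for x
  proof -
    have "m \<le> x"
      using kl(1) cell_index_ge(2)[of k n l] cell_ge[OF that] by linarith
    then show ?thesis
      using m that kl(3) by (metis DiffI UNIV_I disjoint_iff not_less)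
  qed
  then show thesis
    using that kl(2) by blast
qed

lemma mathias_adds_dominating_real:
  assumes "\<And>A. A \<in> \<A> \<Longrightarrow> thin A" "\<And>f. \<exists>A\<in>\<A>. meets_rows f A"
  shows "adds_dominating_real (mathias_set (F_of \<A>)) mathias_le"
proof -
  let ?P = "mathias_set (F_of \<A>)"
  \<comment> \<open>The stem contains a whole cell of \<open>row n k\<close>; the least such k is
    the value of the dominating real at n.\<close>
  define \<tau> :: "nat \<Rightarrow> nat \<Rightarrow> (nat set \<times> nat set) set" where
    "\<tau> n k = {(s, F). \<exists>l\<le>k. cell (cell_index n k l) \<subseteq> s}" for n k
  have "\<exists>q\<in>?P. mathias_le q p \<and> (\<exists>m. forces_meets ?P mathias_le (\<tau> n m) q)" if P: "p \<in> ?P" for n p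
  proof -
    obtain s F where p: "p = (s, F)" "finite s" "F \<in> F_of \<A>"
      using P unfolding mathias_set_def by blast
    \<comment> \<open>Points up to \<open>Max s\<close> are removed so that the new stem end-extends
      s.\<close>
    then obtain k l where kl: "l \<le> k" "cell (cell_index n k l) \<subseteq> F - {..Max s}"
      using F_of_contains_cell[OF assms(1) F_of_Diff_finite[OF p(3)]] by (metis finite_atMost)
    define q where "q = (s \<union> cell (cell_index n k l), F)"
    have "q \<in> ?P"
      using p finite_cell unfolding q_def mathias_set_def by simp
    moreover have "mathias_le q p"
      using kl(2) Max_ge[OF p(2)] unfolding q_def p(1) mathias_le_def end_extends_def
      by (fastforce simp: not_le)
    moreover have "q \<in> \<tau> n k"
      using kl(1) unfolding q_def \<tau>_def by blast
    then have "forces_meets ?P mathias_le (\<tau> n k) q"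
      using \<open>q \<in> ?P\<close> mathias_le_refl unfolding forces_meets_def by blast
    ultimately show ?thesis
      by blast
  qed
  moreover have "\<exists>q\<in>?P. mathias_le q p \<and> (\<exists>k. \<forall>n\<ge>k. \<forall>m<f n.
      \<not> (\<exists>r\<in>?P. mathias_le r q \<and> forces_meets ?P mathias_le (\<tau> n m) r))" if P: "p \<in> ?P" for f p
  proof -
    obtain s F where p: "p = (s, F)" "finite s" "F \<in> F_of \<A>"
      using P unfolding mathias_set_def by blast
    obtain A where A: "A \<in> \<A>" "meets_rows f A"
      using assms(2) by blast
    \<comment> \<open>Removing A from the side set keeps later stems from acquiring points of A, and
      A meets every cell of \<open>row n m\<close> with m < f n.\<close>
    define q where "q = (s, F - A)"
    have "q \<in> ?P"
      using p F_of_Diff_member[OF p(3) A(1)] unfolding q_def mathias_set_def by simp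
    moreover have "mathias_le q p"
      unfolding q_def p(1) mathias_le_def end_extends_def by auto
    moreover have False
      if n: "Suc (Max s) \<le> n" "m < f n" and r: "r \<in> ?P" "mathias_le r q"
        "forces_meets ?P mathias_le (\<tau> n m) r" for n m r
    proof -
      obtain r' u where r': "mathias_le r' r" "u \<in> \<tau> n m" "mathias_le r' u"
        using r(1,3) mathias_le_refl unfolding forces_meets_def by blast
      then obtain l where l: "l \<le> m" "cell (cell_index n m l) \<subseteq> fst u"
        unfolding \<tau>_def by auto
      obtain x where x: "x \<in> A" "x \<in> cell (cell_index n m l)"
        using A(2) n(2) l(1) unfolding meets_rows_def by blast
      \<comment> \<open>Points of this cell are at least n, which exceeds \<open>Max s\<close>, so x
        would have to enter the stem from \<open>F - A\<close>.\<close>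
      have "x \<notin> s"
        using n(1) cell_index_ge(1)[of n m l] cell_ge[OF x(2)] Max_ge[OF p(2), of x] by linarith
      moreover have "x \<in> fst r'"
        using l(2) x(2) r'(3) unfolding mathias_le_def end_extends_def by blast
      moreover have "mathias_le r' q"
        using r'(1) r(2) mathias_le_trans by blast
      ultimately show False
        using x(1) unfolding q_def mathias_le_def by auto
    qed
    ultimately show ?thesis
      by blast
  qed
  ultimately show ?thesis
    unfolding adds_dominating_real_def by blast
qed

section \<open>Infinitude and maximality of the constructed family\<close>

theorem theorem1:
  assumes "p_eq_c" and "covN_eq_c"
  shows "\<exists>\<A>. cohen_indestructible \<A> \<and>
           adds_dominating_real (mathias_set (F_of \<A>)) mathias_le"
proof -
  obtain \<A> where \<A>: "thin_ad_family \<A>" "\<And>t. fulfils \<A> t"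
    using exists_thin_ad_family_fulfilling[OF assms] by blast
  have thin: "thin A" if "A \<in> \<A>" for A
    using \<A>(1) that unfolding thin_ad_family_def by blast
  have fm: "forces_maximal UNIV cohen_le \<A>"
    unfolding forces_maximal_def
  proof (intro allI ballI impI)
    fix \<sigma> p assume "forces_inf UNIV cohen_le \<sigma> p"
    then show "\<exists>q\<in>UNIV. cohen_le q p \<and> (\<exists>A\<in>\<A>. forces_inf_inter UNIV cohen_le \<sigma> A q)"
      using \<A>(2)[of "Inl (\<sigma>, p)"] by auto
  qed
  have "infinite \<A>"
  proof
    assume "finite \<A>"
    \<comment> \<open>A finite union of thin sets misses cells arbitrarily far out, so its
      complement is infinite; being disjoint from every member, it contradicts maximality.\<close>
    have "infinite (- \<Union>\<A>)"
      unfolding infinite_nat_iff_unbounded_le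
    proof
      fix m
      obtain k l where kl: "m \<le> k" "cell (cell_index 0 k l) \<inter> \<Union>\<A> = {}"
        using finite_thin_union_misses_cell[OF \<open>finite \<A>\<close> thin] by metis
      obtain x where x: "x \<in> cell (cell_index 0 k l)"
        using selector_in_cell by blast
      then have "m \<le> x"
        using kl(1) cell_index_ge(2)[of k 0 l] cell_ge by (meson le_trans)
      then show "\<exists>x\<ge>m. x \<in> - \<Union>\<A>"
        using x kl(2) by blast
    qed
    then obtain A where "A \<in> \<A>" "infinite (- \<Union>\<A> \<inter> A)"
      using forces_maximal_cohen_imp_maximal[OF fm] by blast
    moreover have "- \<Union>\<A> \<inter> A = {}"
      using \<open>A \<in> \<A>\<close> by blast
    ultimately show False
      by simp
  qed
  then have "mad_family \<A>"
    using \<A>(1) forces_maximal_cohen_imp_maximal[OF fm]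
    unfolding mad_family_def thin_ad_family_def by metis
  moreover have "\<exists>A\<in>\<A>. meets_rows f A" for f
    using \<A>(2)[of "Inr f"] by simp
  ultimately show ?thesis
    using fm thin mathias_adds_dominating_real unfolding cohen_indestructible_def by blast
qed

end
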